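(* For $k\in\mathbb Z$, the following estimate holds: $$\mathbb J_{x+k}(-x)=\frac{(-1)^k}{3\pi}\left\{\Gamma\left(\tfrac13\right)\left[\frac6x\right]^{1/3}\cos\left(\pi\left(x-\tfrac16\right)\right)-k\,\Gamma\left(\tfrac23\right)\left[\frac6x\right]^{2/3}\sin\left(\pi\left(x-\tfrac13\right)\right)\right\}+R,$$ with $|R|\le C\,\dfrac{1+|k|^3}{x}$ when $|x|>2$. Here the constant $C$ does not depend on $x$ and $k$.
   Context: Anger's function is $\mathbb J_\gamma(x):=\frac1\pi\int_0^\pi\cos(\gamma\theta-x\sin\theta)\,d\theta$ for real $\gamma,x$. $\Gamma$ is Euler's Gamma function.
   Formalization: The sign of the k-term is + instead of − (the printed sign fails for k=1 as x→∞); the bound reads C(1+|k|^3)/|x|; for x<−2 the main term has |x| in place of x and the k-term is multiplied by sgn x. *)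

theory Defs
  imports "HOL-Analysis.Analysis"
begin

definition anger :: "real \<Rightarrow> real \<Rightarrow> real" where
  "anger \<gamma> x = (1 / pi) * integral {0..pi} (\<lambda>\<theta>. cos (\<gamma> * \<theta> - x * sin \<theta>))"

(*
  Leading terms of anger (x + k) (-x).  With theta = pi - t the phase becomes
    pi * (x + k) - x * (t - sin t) - k * t,
  with a degenerate stationary point at t = 0, and
    cos (pi * x - x * t^3 / 6 - k * t)
      = cos (pi * x - x * t^3 / 6) + k * t * sin (pi * x - x * t^3 / 6) + ...
  so for x > 0 the k-term carries a plus sign.  The case x < 0 follows from
  anger (x + k) (-x) = anger (\<bar>x\<bar> - k) (- \<bar>x\<bar>), which replaces k by -k: hence sgn x.
*)
definition anger_main :: "int \<Rightarrow> real \<Rightarrow> real" where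
  "anger_main k x =
     (-1) powi k / (3 * pi) *
       (Gamma (1/3) * (6 / \<bar>x\<bar>) powr (1/3) * cos (pi * (\<bar>x\<bar> - 1/6))
        + sgn x * of_int k * Gamma (2/3) * (6 / \<bar>x\<bar>) powr (2/3) * sin (pi * (\<bar>x\<bar> - 1/3)))"

end

theory Submission
  imports Defs "HOL-Complex_Analysis.Cauchy_Integral_Theorem"
begin

text \<open>
  Substituting \<open>\<theta> = \<pi> - t\<close> turns the integral into the real part of
  \<open>(-1)\<^sup>k e\<^sup>i\<^sup>\<pi>\<^sup>x\<close> times the integral of \<open>exp (- i (x (t - sin t) + k t))\<close> over \<open>[0, \<pi>]\<close>.
  The integrand is entire, so the path can be pushed into the lower half plane: along
  the ray from \<open>0\<close> to \<open>\<omega> = exp (- i \<pi> / 6)\<close>, horizontally to \<open>\<pi> - i / 2\<close> and vertically up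
  to \<open>\<pi>\<close>. The last two pieces are exponentially small and \<open>O(1 / x)\<close>, respectively. On the ray
  \<open>z = r \<omega>\<close> the leading phase \<open>- i x z\<^sup>3 / 6\<close> becomes the real number \<open>- x r\<^sup>3 / 6\<close>, so that
  everything converges absolutely: replacing the integrand by
  \<open>(1 - i k z) exp (- x r\<^sup>3 / 6)\<close> costs \<open>O((1 + k\<^sup>2) r\<^sup>2 exp (- x r\<^sup>3 / 48))\<close> pointwise, which
  integrates to \<open>O((1 + k\<^sup>2) / x)\<close>, and what remains are two Gamma integrals. This needs
  \<open>\<bar>k\<bar>\<^sup>3 \<le> x\<close>; otherwise the error bound exceeds \<open>1\<close> and a crude estimate of both sides suffices.
\<close>

section \<open>Gamma integrals with a cubic exponent\<close>

text \<open>Euler's integral for \<open>Gamma a\<close> under the substitution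
  \<open>t = x * r ^ 3 / 6\<close>. The transformed integrand is
  \<open>3 * (x / 6) powr a * r powr (3 * a - 1)\<close> times the exponential, whence the factor
  \<open>(6 / x) powr a / 3\<close>.\<close>

lemma has_integral_Gamma_cube:
  fixes a x :: real
  assumes a: "a > 0" and x: "x > 0"
  shows "((\<lambda>r. r powr (3 * a - 1) * exp (- (x * r ^ 3 / 6)))
           has_integral Gamma a * (6 / x) powr a / 3) {0<..}"
proof -
  let ?f = "\<lambda>t::real. t powr (a - 1) / exp t"
  let ?g = "\<lambda>r::real. x * r ^ 3 / 6"
  have "(?f has_integral Gamma a) {0<..}"
    using Gamma_integral_real[OF a]
    by (rule has_integral_spike_set_eq[THEN iffD1, rotated -1])
      (auto intro: negligible_subset[of "{0}"])
  then have "?f integrable_on {0<..}" "integral {0<..} ?f = Gamma a"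
    by (auto simp: integral_unique)
  moreover from this(1) have "?f absolutely_integrable_on {0<..}"
    by (rule nonnegative_absolutely_integrable_1) auto
  moreover have im: "?g ` {0<..} = {0<..}"
  proof (intro equalityI subsetI)
    fix t :: real assume "t \<in> {0<..}"
    then have "t = ?g (root 3 (6 * t / x))" "root 3 (6 * t / x) \<in> {0<..}"
      using x by simp_all
    then show "t \<in> ?g ` {0<..}" by blast
  qed (use x in auto)
  moreover have "inj_on ?g {0<..}"
    using x by (auto simp: inj_on_def power_eq_iff_eq_base)
  moreover have "(?g has_field_derivative x * r\<^sup>2 / 2) (at r within {0<..})" for r
    by (auto intro!: derivative_eq_intros)
  ultimately have "(\<lambda>r. \<bar>x * r\<^sup>2 / 2\<bar> * ?f (?g r)) absolutely_integrable_on {0<..} \<and>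
      integral {0<..} (\<lambda>r. \<bar>x * r\<^sup>2 / 2\<bar> * ?f (?g r)) = Gamma a"
    by (subst has_absolute_integral_change_of_variables_1') auto
  then have "((\<lambda>r. \<bar>x * r\<^sup>2 / 2\<bar> * ?f (?g r)) has_integral Gamma a) {0<..}"
    using set_lebesgue_integral_eq_integral(1) by (auto simp: has_integral_iff)
  then have "((\<lambda>r. ((6 / x) powr a / 3) * (\<bar>x * r\<^sup>2 / 2\<bar> * ?f (?g r))) has_integral
      (6 / x) powr a / 3 * Gamma a) {0<..}"
    by (rule has_integral_mult_right)
  then have "((\<lambda>r. ((6 / x) powr a / 3) * (\<bar>x * r\<^sup>2 / 2\<bar> * ?f (?g r))) has_integral
      Gamma a * (6 / x) powr a / 3) {0<..}"
    by (simp add: mult.commute)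
  then show ?thesis
  proof (rule has_integral_eq[rotated])
    fix r :: real assume "r \<in> {0<..}"
    then have r: "r > 0" by simp
    have "r powr (3 * a - 1) = (r powr 3) powr a / r"
      using r by (simp only: powr_diff powr_powr powr_one)
    also have "r powr 3 = r ^ 3"
      using r by simp
    finally show "(6 / x) powr a / 3 * (\<bar>x * r\<^sup>2 / 2\<bar> * ?f (?g r)) =
        r powr (3 * a - 1) * exp (- (x * r ^ 3 / 6))"
      using r x by (simp add: powr_diff powr_mult powr_divide exp_minus field_simps
          power2_eq_square power3_eq_cube)
  qed
qed


text \<open>The error is the tail over \<open>r > 1\<close>. There \<open>r ^ j \<le> r ^ 2\<close>,
  so the tail is at most the one for \<open>j = 2\<close>, hence at most the full integral for
  \<open>j = 2\<close>, which is exactly \<open>2 / x\<close> because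
  \<open>Gamma 1 = 1\<close>.\<close>

lemma integral_power_exp_cube:
  fixes x :: real
  assumes x: "x > 0" and j: "j \<le> 2"
  shows "\<bar>integral {0..1} (\<lambda>r. r ^ j * exp (- (x * r ^ 3 / 6))) -
           Gamma (real (Suc j) / 3) * (6 / x) powr (real (Suc j) / 3) / 3\<bar> \<le> 2 / x"
proof -
  let ?F = "\<lambda>j r :: real. r ^ j * exp (- (x * r ^ 3 / 6))"
  let ?G = "\<lambda>j. Gamma (real (Suc j) / 3) * (6 / x) powr (real (Suc j) / 3) / 3"
  have G: "(?F j has_integral ?G j) {0<..}" for j
  proof (rule has_integral_eq[rotated])
    show "((\<lambda>r. r powr (3 * (real (Suc j) / 3) - 1) * exp (- (x * r ^ 3 / 6))) has_integral ?G j) {0<..}"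
      using x by (intro has_integral_Gamma_cube) auto
  qed (auto simp: powr_realpow add_divide_distrib)
  have I: "(?F j has_integral integral {0..1} (?F j)) {0<..1}" for j
  proof -
    have "(?F j has_integral integral {0..1} (?F j)) {0..1}"
      by (intro integrable_integral integrable_continuous_interval continuous_intros) auto
    then show ?thesis
      by (rule has_integral_spike_set_eq[THEN iffD1, rotated -1])
        (rule negligible_subset[of "{0}"]; auto)+
  qed
  have D: "(?F j has_integral ?G j - integral {0..1} (?F j)) ({0<..} - {0<..1})" for j
    by (rule has_integral_setdiff[OF G I]) (rule negligible_subset[of "{}"]; auto)
  have "0 \<le> ?G j - integral {0..1} (?F j)"
    by (rule has_integral_nonneg[OF D]) auto
  moreover have "?G j - integral {0..1} (?F j) \<le> ?G 2 - integral {0..1} (?F 2)"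
    using j by (intro has_integral_le[OF D D]) (auto intro!: power_increasing)
  moreover have "integral {0..1} (?F 2) \<ge> 0"
    by (rule has_integral_nonneg[OF I]) auto
  moreover have "?G 2 = 2 / x"
    using x by simp
  ultimately show ?thesis
    by linarith
qed

section \<open>Elementary inequalities\<close>

text \<open>The cubic \<open>u ^ 3 / 48\<close> touches the line \<open>u - 8 / 3\<close> at
  \<open>u = 4\<close>; the constant is rounded up to 4. When
  \<open>\<bar>k\<bar> ^ 3 \<le> x\<close>, this lets the decay in \<open>x\<close> absorb the
  growth caused by \<open>k\<close>.\<close>

lemma cubic_dominates:
  fixes u :: real
  assumes "u \<ge> 0"
  shows "u \<le> 4 + u ^ 3 / 48"
proof -
  have "0 \<le> (u - 4)\<^sup>2 * (u + 8)"
    using assms by simp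
  also have "\<dots> = u ^ 3 - 48 * u + 128"
    by (simp add: power2_eq_square power3_eq_cube algebra_simps)
  finally show ?thesis by simp
qed

text \<open>The coefficient of \<open>z ^ 4\<close> in the sine series vanishes, so the Taylor
  polynomial of degree 4 leaves a remainder of order 5. Its constant is
  \<open>exp \<bar>Im z\<bar> / 24\<close>, at most \<open>2 / 24\<close> because
  \<open>e < 4\<close>.\<close>

lemma sin_cubic_remainder:
  fixes z :: complex
  assumes "norm z \<le> 1" "\<bar>Im z\<bar> \<le> 1 / 2"
  shows "norm (z - sin z - z ^ 3 / 6) \<le> norm z ^ 5 / 12"
proof -
  have "exp (1 / 2 :: real) ^ 2 = exp 1"
    by (simp flip: exp_double)
  then have "exp (1 / 2 :: real) ^ 2 \<le> 2 ^ 2"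
    using e_less_272 by simp
  then have "exp (1 / 2 :: real) \<le> 2"
    by (rule power2_le_imp_le) simp
  moreover have "exp \<bar>Im z\<bar> \<le> exp (1 / 2)"
    using assms by simp
  ultimately have "exp \<bar>Im z\<bar> \<le> 2"
    by linarith
  moreover have "norm (sin z - (z - z ^ 3 / 6)) \<le> exp \<bar>Im z\<bar> * norm z ^ 5 / 24"
  proof -
    have "{..4::nat} = {0, 1, 2, 3, 4}"
      by auto
    then have "(\<Sum>i\<le>4. complex_of_real (sin_coeff i) * z ^ i) = z - z ^ 3 / 6"
      by (simp add: sin_coeff_def fact_numeral)
    then show ?thesis
      using Taylor_sin[of z 4] by (simp add: fact_numeral)
  qed
  moreover have "exp \<bar>Im z\<bar> * norm z ^ 5 \<le> 2 * norm z ^ 5"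
    using calculation by (intro mult_right_mono) auto
  ultimately have "norm (sin z - (z - z ^ 3 / 6)) \<le> 2 * norm z ^ 5 / 24"
    by linarith
  then show ?thesis
    by (simp add: norm_minus_commute algebra_simps)
qed

section \<open>The complex kernel and its expansion on the ray\<close>

definition phase_kernel :: "real \<Rightarrow> real \<Rightarrow> complex \<Rightarrow> complex" where
  "phase_kernel x k z = exp (- (\<i> * (of_real x * (z - sin z) + of_real k * z)))"

lemma norm_phase_kernel:
  "norm (phase_kernel x k z) =
     exp (x * (Im z - cos (Re z) * (exp (Im z) - exp (- Im z)) / 2) + k * Im z)"
  by (simp add: phase_kernel_def Im_sin)

lemma exp_remainder:
  fixes w :: complex
  shows "norm (exp w - 1 - w) \<le> exp (norm w) * norm w ^ 2"
  using Taylor_exp_field[of w 1] by (simp add: power2_eq_square diff_diff_eq)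

text \<open>On the ray \<open>z ^ 3 = - \<i> * r ^ 3\<close>, so the kernel factors as
  \<open>exp (- (v / 6)) * exp w\<close>, where \<open>w\<close> collects the \<open>k\<close>-term
  and the sine remainder \<open>h\<close>. The error consists of the second-order remainder of
  \<open>exp w\<close> and the term \<open>x * h\<close>, both absorbed by part of the
  decay.\<close>

lemma phase_kernel_ray:
  fixes x k r :: real
  defines "z \<equiv> of_real r * cis (- (pi / 6))"
  assumes x: "x > 0" and k: "\<bar>k\<bar> ^ 3 \<le> x" and r: "0 \<le> r" "r \<le> 1"
  shows "norm (phase_kernel x k z - (1 - \<i> * of_real k * z) * of_real (exp (- (x * r ^ 3 / 6))))
           \<le> 3459 * exp 4 * (1 + k\<^sup>2) * (r\<^sup>2 * exp (- (x * r ^ 3 / 48)))"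
proof -
  define v u where "v = x * r ^ 3" and "u = \<bar>k\<bar> * r"
  have v0: "v \<ge> 0" and u0: "u \<ge> 0"
    using x r by (simp_all add: v_def u_def)
  have nz: "norm z = r"
    using r by (simp add: z_def norm_mult)
  have z3: "z ^ 3 = - \<i> * of_real (r ^ 3)"
  proof -
    have "cis (- (pi / 6)) ^ 3 = - \<i>"
      using Complex.DeMoivre[of "- (pi / 6)" 3] by simp
    then show ?thesis
      by (simp add: z_def power_mult_distrib)
  qed
  define h where "h = z - sin z - z ^ 3 / 6"
  have h: "norm h \<le> r ^ 5 / 12"
    using sin_cubic_remainder[of z] r
    by (simp add: h_def nz) (simp add: z_def sin_30)
  define w where "w = - (\<i> * (of_real x * h + of_real k * z))"
  have K: "phase_kernel x k z = of_real (exp (- (v / 6))) * exp w"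
  proof -
    have "- (\<i> * (of_real x * (z - sin z) + of_real k * z)) = of_real (- (v / 6)) + w"
      by (simp add: w_def h_def z3 v_def algebra_simps)
    then show ?thesis
      by (simp only: phase_kernel_def exp_add exp_of_real)
  qed
  have xh: "norm (of_real x * h) \<le> r\<^sup>2 * v / 12"
    using mult_left_mono[OF h, of x] x
    by (simp add: norm_mult v_def power_add[symmetric] mult_ac flip: power_add)
  have r2: "r\<^sup>2 \<le> 1"
    using r by (simp add: power_le_one)
  have nw': "norm w \<le> r\<^sup>2 * v / 12 + u"
  proof -
    have "norm w \<le> norm (of_real x * h) + norm (of_real k * z)"
      unfolding w_def norm_minus_cancel norm_mult norm_ii
      by (metis mult_1 norm_mult norm_triangle_ineq)
    then show ?thesis
      using xh r by (simp add: norm_mult nz u_def)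
  qed
  then have nw: "norm w \<le> v / 12 + u"
    using mult_right_mono[OF r2 v0] by simp
  \<comment> \<open>The factor \<open>r\<^sup>2\<close> must survive: integrated against
    \<open>exp (- (x * r ^ 3 / 48))\<close> it gives order \<open>1 / x\<close>, whereas estimating
    it by 1 would leave only \<open>x powr (- 1 / 3)\<close>.\<close>
  have nw2: "norm w ^ 2 \<le> 2 * r\<^sup>2 * (1 + k\<^sup>2) * (1 + v\<^sup>2)"
  proof -
    have "norm w ^ 2 \<le> (r\<^sup>2 * v / 12 + u)\<^sup>2"
      using nw' by (intro power_mono) auto
    also have "\<dots> \<le> 2 * (r\<^sup>2 * v / 12)\<^sup>2 + 2 * u\<^sup>2"
      using sum_squares_bound[of "r\<^sup>2 * v / 12" u] by (simp add: power2_sum)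
    also have "(r\<^sup>2 * v / 12)\<^sup>2 \<le> r\<^sup>2 * v\<^sup>2"
    proof -
      have "r\<^sup>2 * (r\<^sup>2 * v\<^sup>2 / 144) \<le> r\<^sup>2 * (1 * v\<^sup>2)"
        using mult_right_mono[OF r2 zero_le_power2[of v]] zero_le_power2[of v]
        by (intro mult_left_mono zero_le_power2) linarith
      then show ?thesis
        by (simp add: power_mult_distrib power_divide power2_eq_square mult_ac)
    qed
    also have "u\<^sup>2 = k\<^sup>2 * r\<^sup>2"
      by (simp add: u_def power_mult_distrib)
    finally have "norm w ^ 2 \<le> 2 * r\<^sup>2 * (v\<^sup>2 + k\<^sup>2)"
      by (simp add: algebra_simps)
    also have "\<dots> \<le> 2 * r\<^sup>2 * ((1 + k\<^sup>2) * (1 + v\<^sup>2))"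
      by (intro mult_left_mono) (simp_all add: algebra_simps)
    finally show ?thesis by (simp add: mult_ac)
  qed
  have v_le: "r\<^sup>2 * v / 12 \<le> r\<^sup>2 * (1 + k\<^sup>2) * (1 + v\<^sup>2)"
  proof -
    have "v / 12 \<le> 1 * (1 + v\<^sup>2)"
      using sum_squares_bound[of 1 v] v0 by simp
    also have "\<dots> \<le> (1 + k\<^sup>2) * (1 + v\<^sup>2)"
      by (intro mult_right_mono) auto
    finally have "r\<^sup>2 * (v / 12) \<le> r\<^sup>2 * ((1 + k\<^sup>2) * (1 + v\<^sup>2))"
      by (intro mult_left_mono) auto
    then show ?thesis by (simp add: mult_ac)
  qed
  have "norm (exp w - (1 - \<i> * of_real k * z)) \<le> norm (exp w - 1 - w) + norm (of_real x * h)"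
  proof -
    have "exp w - (1 - \<i> * of_real k * z) = (exp w - 1 - w) + (- \<i>) * (of_real x * h)"
      by (simp add: w_def algebra_simps)
    then show ?thesis
      by (metis norm_triangle_ineq norm_mult norm_minus_cancel norm_ii mult_1)
  qed
  also have "\<dots> \<le> exp (norm w) * (2 * r\<^sup>2 * (1 + k\<^sup>2) * (1 + v\<^sup>2)) +
      exp (norm w) * (r\<^sup>2 * (1 + k\<^sup>2) * (1 + v\<^sup>2))"
  proof (intro add_mono)
    show "norm (exp w - 1 - w) \<le> exp (norm w) * (2 * r\<^sup>2 * (1 + k\<^sup>2) * (1 + v\<^sup>2))"
      by (rule order_trans[OF exp_remainder mult_left_mono[OF nw2]]) simp
    have "1 * (r\<^sup>2 * (1 + k\<^sup>2) * (1 + v\<^sup>2)) \<le> exp (norm w) * (r\<^sup>2 * (1 + k\<^sup>2) * (1 + v\<^sup>2))"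
      by (intro mult_right_mono) auto
    then show "norm (of_real x * h) \<le> exp (norm w) * (r\<^sup>2 * (1 + k\<^sup>2) * (1 + v\<^sup>2))"
      using xh v_le by linarith
  qed
  finally have E: "norm (exp w - (1 - \<i> * of_real k * z))
      \<le> 3 * r\<^sup>2 * (1 + k\<^sup>2) * ((1 + v\<^sup>2) * exp (norm w))"
    by (simp add: algebra_simps)
  have "norm (phase_kernel x k z - (1 - \<i> * of_real k * z) * of_real (exp (- (v / 6)))) =
      exp (- (v / 6)) * norm (exp w - (1 - \<i> * of_real k * z))"
  proof -
    have "phase_kernel x k z - (1 - \<i> * of_real k * z) * of_real (exp (- (v / 6))) =
        of_real (exp (- (v / 6))) * (exp w - (1 - \<i> * of_real k * z))"
      unfolding K by (simp add: algebra_simps)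
    then show ?thesis
      by (simp only: norm_mult norm_of_real abs_exp_cancel)
  qed
  also have "\<dots> \<le> exp (- (v / 6)) * (3 * r\<^sup>2 * (1 + k\<^sup>2) * ((1 + v\<^sup>2) * exp (norm w)))"
    using E by (intro mult_left_mono) auto
  also have "\<dots> = 3 * r\<^sup>2 * (1 + k\<^sup>2) * ((1 + v\<^sup>2) * exp (norm w - v / 6))"
  proof -
    have "exp (norm w - v / 6) = exp (- (v / 6)) * exp (norm w)"
      by (simp flip: exp_add)
    then show ?thesis by (simp only: mult_ac)
  qed
  \<comment> \<open>Since \<open>u ^ 3 \<le> v\<close>, the exponent is at most
    \<open>v / 12 + (4 + v / 48) - v / 6 = 4 - v / 16\<close>. The polynomial
    \<open>1 + v\<^sup>2\<close> costs a further \<open>exp (v / 24)\<close>, with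
    \<open>1153 = 1 + 2 * 24\<^sup>2\<close>; the decay \<open>exp (- (v / 48))\<close> is
    left.\<close>
  also have "\<dots> \<le> 3 * r\<^sup>2 * (1 + k\<^sup>2) * (1153 * exp (v / 24) * exp (4 - v / 16))"
  proof (intro mult_left_mono mult_mono)
    have "u ^ 3 \<le> v"
      using mult_right_mono[OF k, of "r ^ 3"] r by (simp add: u_def v_def power_mult_distrib)
    then show "exp (norm w - v / 6) \<le> exp (4 - v / 16)"
      using nw cubic_dominates[OF u0] by simp
    have "v\<^sup>2 / 1152 \<le> exp (v / 24)"
      using exp_lower_Taylor_quadratic[of "v / 24"] v0 by (simp add: power_divide)
    moreover have "1 \<le> exp (v / 24)"
      using v0 by simp
    ultimately show "1 + v\<^sup>2 \<le> 1153 * exp (v / 24)"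
      by linarith
  qed auto
  also have "\<dots> = 3459 * exp 4 * (1 + k\<^sup>2) * (r\<^sup>2 * exp (- (v / 48)))"
  proof -
    have "exp (v / 24) * exp (4 - v / 16) = exp 4 * exp (- (v / 48))"
      by (simp flip: exp_add)
    then show ?thesis by algebra
  qed
  finally show ?thesis
    by (simp add: v_def)
qed

section \<open>Deformation of the contour\<close>

text \<open>Expresses integrals along rays through a primitive, so that deforming the path amounts
  to comparing values of \<open>P\<close>. It is applied with \<open>c = 1\<close> for the real
  segment and with \<open>c = \<omega>\<close> for the ray.\<close>

lemma has_integral_ray:
  fixes P f :: "complex \<Rightarrow> complex"
  assumes P: "\<And>z. (P has_field_derivative f z) (at z)" and L: "0 \<le> L"
  shows "((\<lambda>r. c * f (of_real r * c)) has_integral P (of_real L * c) - P 0) {0..L}"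
proof -
  have "((\<lambda>r. c * f (of_real r * c)) has_integral P (of_real L * c) - P (of_real 0 * c)) {0..L}"
  proof (rule fundamental_theorem_of_calculus[OF L])
    fix r :: real
    have "((\<lambda>r. of_real r * c) has_vector_derivative of_real 1 * c) (at r within {0..L})"
      by (intro has_vector_derivative_mult_left has_vector_derivative_of_real
          DERIV_ident)
    from field_vector_diff_chain_within[OF this has_field_derivative_at_within[OF P]]
    show "((\<lambda>r. P (of_real r * c)) has_vector_derivative c * f (of_real r * c)) (at r within {0..L})"
      by (simp add: o_def)
  qed
  then show ?thesis by simp
qed

text \<open>The exponent is \<open>x * (cos (Re z) * S - 1 / 2) - k / 2\<close> with
  \<open>S = sinh (1 / 2) \<le> 0.6\<close>. As \<open>Re z \<ge> sqrt 3 / 2 > pi / 4\<close>, the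
  cosine is at most 0.72, so the first term is at most \<open>- x / 20\<close>. The
  \<open>k\<close>-term costs at most \<open>2 + x / 96\<close>, leaving \<open>2 - x / 40\<close>;
  finally \<open>exp (- x / 40) \<le> 40 / x\<close>.\<close>

lemma phase_kernel_horizontal:
  assumes x: "x > 0" and k: "\<bar>k\<bar> ^ 3 \<le> x"
    and z: "Im z = - (1 / 2)" "sqrt 3 / 2 \<le> Re z" "Re z \<le> pi"
  shows "norm (phase_kernel x k z) \<le> 40 * exp 2 / x"
proof -
  define S where "S = (exp (1 / 2) - exp (- (1 / 2))) / (2::real)"
  have S: "S \<le> 6 / 10"
  proof -
    have "exp (1 / 2 :: real) ^ 2 = exp 1"
      by (simp flip: exp_double)
    then have "exp (1 / 2 :: real) ^ 2 \<le> (17 / 10) ^ 2"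
      using e_less_272 by (simp add: power2_eq_square)
    then have "exp (1 / 2 :: real) \<le> 17 / 10"
      by (rule power2_le_imp_le) simp
    then show ?thesis
      using exp_ge_add_one_self[of "- (1 / 2) :: real"] by (simp add: S_def)
  qed
  have S0: "S \<ge> 0"
    by (simp add: S_def)
  have "cos (Re z) \<le> cos (pi / 4)"
  proof (rule cos_monotone_0_pi_le)
    have pi_upper: "pi \<le> 32 / 10"
      using pi_approx by simp
    have "17 / 10 \<le> sqrt 3"
      by (rule real_le_rsqrt) (simp add: power2_eq_square)
    then show "pi / 4 \<le> Re z"
      using z pi_upper by linarith
  qed (use z in auto)
  moreover have "sqrt 2 \<le> 144 / 100"
    by (rule real_le_lsqrt) (simp_all add: power2_eq_square)
  ultimately have c: "cos (Re z) \<le> 72 / 100"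
    by (simp add: cos_45)
  have "cos (Re z) * S \<le> 72 / 100 * S"
    by (rule mult_right_mono[OF c S0])
  then have "cos (Re z) * S \<le> 45 / 100"
    using S by linarith
  then have "x * (cos (Re z) * S - 1 / 2) \<le> x * (- (1 / 20))"
    using x by (intro mult_left_mono) auto
  moreover have "\<bar>k\<bar> \<le> 4 + x / 48"
    using cubic_dominates[of "\<bar>k\<bar>"] k by simp
  ultimately have "x * (cos (Re z) * S - 1 / 2) - k / 2 \<le> 2 - x / 40"
    using x by argo
  then have "norm (phase_kernel x k z) \<le> exp (2 - x / 40)"
    by (simp add: norm_phase_kernel z S_def algebra_simps diff_divide_distrib)
  also have "\<dots> = exp 2 / exp (x / 40)"
    by (simp add: exp_diff)
  also have "\<dots> \<le> exp 2 / (x / 40)"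
    using exp_ge_add_one_self[of "x / 40"] x
    by (intro divide_left_mono mult_pos_pos) (auto simp del: exp_ge_add_one_self)
  finally show ?thesis by (simp add: mult.commute)
qed

text \<open>Because \<open>cos pi = - 1\<close>, the sine contributes decay as well: the exponent is
  \<open>- x * (b + sinh b) - k * b\<close>. With \<open>sinh b \<ge> b / 2\<close> the decay rate
  is at least \<open>3 / 2 * x\<close>, of which \<open>k\<close> consumes at most
  \<open>x\<close>.\<close>

lemma phase_kernel_vertical:
  assumes k: "\<bar>k\<bar> \<le> x" and b: "b \<ge> 0"
  shows "norm (phase_kernel x k (of_real pi - \<i> * of_real b)) \<le> exp (- (x / 2 * b))"
proof -
  have "exp (- b) \<le> 1" "1 + b \<le> exp b"
    using b by auto
  then have "- b - (exp b - exp (- b)) / 2 \<le> - (3 / 2 * b)"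
    by argo
  then have "x * (- b - (exp b - exp (- b)) / 2) \<le> x * (- (3 / 2 * b))"
    using k by (intro mult_left_mono) auto
  also have "\<dots> = - (3 / 2 * (x * b))"
    by simp
  finally have "x * (- b - (exp b - exp (- b)) / 2) \<le> - (3 / 2 * (x * b))" .
  moreover have "- k * b \<le> x * b"
    using k b by (intro mult_right_mono) auto
  ultimately have "x * (- b - (exp b - exp (- b)) / 2) - k * b \<le> - (x / 2 * b)"
    by linarith
  then show ?thesis
    by (simp add: norm_phase_kernel)
qed

lemma holomorphic_phase_kernel: "phase_kernel x k holomorphic_on S"
  unfolding phase_kernel_def by (intro holomorphic_intros)

text \<open>With an entire primitive \<open>P\<close>, the difference of the two integrals is
  \<open>P pi - P \<omega>\<close>. It is estimated through the corner \<open>pi - \<i> / 2\<close>,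
  by one bound for each of the two segments.\<close>

lemma phase_kernel_contour:
  fixes x k :: real
  defines "\<omega> \<equiv> cis (- (pi / 6))"
  assumes x: "x > 2" and k: "\<bar>k\<bar> ^ 3 \<le> x"
  shows "norm (integral {0..pi} (\<lambda>t. phase_kernel x k (of_real t)) -
           integral {0..1} (\<lambda>r. \<omega> * phase_kernel x k (of_real r * \<omega>)))
         \<le> (160 * exp 2 + 2) / x"
proof -
  obtain P where P: "\<And>z. (P has_field_derivative phase_kernel x k z) (at z)"
    using holomorphic_convex_primitive'[OF _ _ holomorphic_phase_kernel, of UNIV x k] by auto
  have "((\<lambda>t. phase_kernel x k (of_real t)) has_integral P (of_real pi) - P 0) {0..pi}"
    using has_integral_ray[OF P, of pi 1] by simp
  then have I1: "integral {0..pi} (\<lambda>t. phase_kernel x k (of_real t)) = P (of_real pi) - P 0"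
    by (rule integral_unique)
  have I2: "integral {0..1} (\<lambda>r. \<omega> * phase_kernel x k (of_real r * \<omega>)) = P \<omega> - P 0"
    using has_integral_ray[OF P, of 1 \<omega>] by (intro integral_unique) simp
  let ?q = "of_real pi - \<i> * of_real (1 / 2) :: complex"
  have \<omega>: "Re \<omega> = sqrt 3 / 2" "Im \<omega> = - (1 / 2)"
    by (simp_all add: \<omega>_def cos_30 sin_30)
  have s3: "sqrt 3 \<le> 2"
    by (rule real_le_lsqrt) auto
  have H: "norm (P ?q - P \<omega>) \<le> 160 * exp 2 / x"
  proof -
    \<comment> \<open>The horizontal line segment, written as an intersection of half-planes so that
      convexity is immediate.\<close>
    let ?S = "{z. - (1 / 2) \<le> Im z} \<inter> {z. Im z \<le> - (1 / 2)} \<inter> {z. sqrt 3 / 2 \<le> Re z} \<inter> {z. Re z \<le> pi}"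
    have "norm (P ?q - P \<omega>) \<le> 40 * exp 2 / x * norm (?q - \<omega>)"
    proof (rule field_differentiable_bound)
      show "convex ?S"
        by (intro convex_Int convex_halfspace_Re_ge convex_halfspace_Re_le
            convex_halfspace_Im_ge convex_halfspace_Im_le)
      show "(P has_field_derivative phase_kernel x k z) (at z within ?S)" for z
        by (rule has_field_derivative_at_within[OF P])
      show "norm (phase_kernel x k z) \<le> 40 * exp 2 / x" if "z \<in> ?S" for z
        using that x k by (intro phase_kernel_horizontal) auto
      show "?q \<in> ?S" "\<omega> \<in> ?S"
        using s3 pi_gt3 by (auto simp: \<omega>)
    qed
    moreover have "norm (?q - \<omega>) \<le> 4"
    proof -
      have "?q - \<omega> = of_real (pi - sqrt 3 / 2)"
        by (simp add: complex_eq_iff \<omega>)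
      then have "norm (?q - \<omega>) = \<bar>pi - sqrt 3 / 2\<bar>"
        by (simp only: norm_of_real)
      then show ?thesis
        using s3 pi_gt3 pi_less_4 real_sqrt_ge_zero[of 3] by linarith
    qed
    then have "40 * exp 2 / x * norm (?q - \<omega>) \<le> 40 * exp 2 / x * 4"
      using x by (intro mult_left_mono) auto
    ultimately show ?thesis
      by simp
  qed
  have kx: "\<bar>k\<bar> \<le> x"
    using k x self_le_power[of "\<bar>k\<bar>" 3]
    by (cases "\<bar>k\<bar> \<le> 1") auto
  \<comment> \<open>A uniform bound on the derivative would not give \<open>1 / x\<close> here. The
    majorant \<open>- (2 / x) * exp (- (x / 2 * b))\<close> has derivative
    \<open>exp (- (x / 2 * b))\<close>, so the generalized mean value inequality integrates the
    pointwise decay.\<close>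
  have V: "norm (P ?q - P (of_real pi - \<i> * of_real 0)) \<le>
      - (2 / x) * exp (- (x / 2 * (1 / 2))) - - (2 / x) * exp (- (x / 2 * 0))"
  proof (rule differentiable_bound_general)
    have D: "((\<lambda>b. P (of_real pi - \<i> * of_real b)) has_vector_derivative
        - \<i> * phase_kernel x k (of_real pi - \<i> * of_real b)) (at b)" for b
    proof -
      have "((\<lambda>b. of_real pi - \<i> * of_real b) has_vector_derivative 0 - \<i> * of_real 1) (at b)"
        by (intro has_vector_derivative_diff has_vector_derivative_const
            has_vector_derivative_mult_right has_vector_derivative_of_real
            DERIV_ident)
      from field_vector_diff_chain_within[OF this has_field_derivative_at_within[OF P]]
      show ?thesis by (simp add: o_def)
    qed
    then show "((\<lambda>b. P (of_real pi - \<i> * of_real b)) has_vector_derivative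
        - \<i> * phase_kernel x k (of_real pi - \<i> * of_real b)) (at b)" for b .
    show "continuous_on {0..1/2} (\<lambda>b. P (of_real pi - \<i> * of_real b))"
      by (intro continuous_at_imp_continuous_on ballI has_vector_derivative_continuous[OF D])
    show "continuous_on {0..1/2} (\<lambda>b. - (2 / x) * exp (- (x / 2 * b)))"
      by (intro continuous_intros)
    show "((\<lambda>b. - (2 / x) * exp (- (x / 2 * b))) has_vector_derivative exp (- (x / 2 * b))) (at b)" for b
      unfolding has_real_derivative_iff_has_vector_derivative[symmetric]
      using x by (auto intro!: derivative_eq_intros)
    show "norm (- \<i> * phase_kernel x k (of_real pi - \<i> * of_real b)) \<le> exp (- (x / 2 * b))"
      if "0 < b" for b
      using phase_kernel_vertical[OF kx, of b] that by (simp add: norm_mult)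
  qed simp
  then have V': "norm (P ?q - P (of_real pi)) \<le> 2 / x"
    using x by (simp add: order_trans)
  have "norm ((P (of_real pi) - P 0) - (P \<omega> - P 0)) =
      norm ((P ?q - P \<omega>) - (P ?q - P (of_real pi)))"
    by simp
  also have "\<dots> \<le> 160 * exp 2 / x + 2 / x"
    using norm_triangle_ineq4[of "P ?q - P \<omega>" "P ?q - P (of_real pi)"] H V' by linarith
  finally show ?thesis
    unfolding I1 I2 by (simp add: add_divide_distrib)
qed


section \<open>Asymptotics of the kernel integral\<close>

lemma has_integral_ray_weight:
  fixes x :: real
  assumes x: "x > 0"
  shows "((\<lambda>r. r\<^sup>2 * exp (- (x * r ^ 3 / 48))) has_integral 16 / x * (1 - exp (- (x / 48)))) {0..1}"
proof -
  have "((\<lambda>r. r\<^sup>2 * exp (- (x * r ^ 3 / 48))) has_integral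
      - (16 / x) * exp (- (x * 1 ^ 3 / 48)) - - (16 / x) * exp (- (x * 0 ^ 3 / 48))) {0..1}"
    by (rule fundamental_theorem_of_calculus)
      (use x in \<open>auto intro!: derivative_eq_intros
        simp flip: has_real_derivative_iff_has_vector_derivative\<close>)
  then show ?thesis by (simp add: algebra_simps)
qed

text \<open>The value of the integral of \<open>r ^ j * exp (- (x * r ^ 3 / 6))\<close> over the
  whole half-line; \<open>j = 0\<close> and \<open>j = 1\<close> produce the two leading
  terms.\<close>

definition gamma_term :: "nat \<Rightarrow> real \<Rightarrow> real" where
  "gamma_term j x = Gamma (real (Suc j) / 3) * (6 / x) powr (real (Suc j) / 3) / 3"

text \<open>Three errors add up: moving the path (\<open>C\<close>), replacing the kernel on the ray
  by its leading part (\<open>A\<close>, with \<open>55344 = 16 * 3459\<close>), and extending the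
  integrals from \<open>{0..1}\<close> to the half-line (\<open>B\<close>).\<close>

lemma phase_kernel_integral:
  fixes x k :: real
  defines "\<omega> \<equiv> cis (- (pi / 6))"
  assumes x: "x > 2" and k: "\<bar>k\<bar> ^ 3 \<le> x"
  shows "norm (integral {0..pi} (\<lambda>t. phase_kernel x k (of_real t)) -
           (\<omega> * of_real (gamma_term 0 x) - \<i> * of_real k * \<omega>\<^sup>2 * of_real (gamma_term 1 x)))
         \<le> (55344 * exp 4 + 160 * exp 2 + 6) * (1 + k\<^sup>2) / x"
proof -
  define E where "E = (\<lambda>j. integral {0..1} (\<lambda>r. r ^ j * exp (- (x * r ^ 3 / 6))))"
  define J where "J = integral {0..1} (\<lambda>r. \<omega> * phase_kernel x k (of_real r * \<omega>))"
  let ?h = "\<lambda>r. \<omega> * ((1 - \<i> * of_real k * (of_real r * \<omega>)) * of_real (exp (- (x * r ^ 3 / 6))))"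
  have n\<omega>: "norm \<omega> = 1"
    by (simp add: \<omega>_def)
  have E: "((\<lambda>r. of_real (r ^ j * exp (- (x * r ^ 3 / 6))) :: complex) has_integral of_real (E j)) {0..1}" for j
    unfolding E_def
    by (intro has_integral_of_real integrable_integral integrable_continuous_interval continuous_intros) auto
  have "((\<lambda>r. \<omega> * of_real (r ^ 0 * exp (- (x * r ^ 3 / 6))) -
        \<i> * of_real k * \<omega>\<^sup>2 * of_real (r ^ 1 * exp (- (x * r ^ 3 / 6)))) has_integral
      \<omega> * of_real (E 0) - \<i> * of_real k * \<omega>\<^sup>2 * of_real (E 1)) {0..1}"
    by (intro has_integral_diff has_integral_mult_right E)
  then have h: "(?h has_integral \<omega> * of_real (E 0) - \<i> * of_real k * \<omega>\<^sup>2 * of_real (E 1)) {0..1}"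
    by (rule has_integral_eq[rotated]) (simp add: algebra_simps power2_eq_square)
  have J: "((\<lambda>r. \<omega> * phase_kernel x k (of_real r * \<omega>)) has_integral J) {0..1}"
    unfolding J_def phase_kernel_def
    by (intro integrable_integral integrable_continuous_interval continuous_intros)
  have W: "((\<lambda>r. 3459 * exp 4 * (1 + k\<^sup>2) * (r\<^sup>2 * exp (- (x * r ^ 3 / 48)))) has_integral
      3459 * exp 4 * (1 + k\<^sup>2) * (16 / x * (1 - exp (- (x / 48))))) {0..1}"
    using x by (intro has_integral_mult_right has_integral_ray_weight) auto
  have "norm (J - (\<omega> * of_real (E 0) - \<i> * of_real k * \<omega>\<^sup>2 * of_real (E 1)))
      \<le> 3459 * exp 4 * (1 + k\<^sup>2) * (16 / x * (1 - exp (- (x / 48))))"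
  \<comment> \<open>Both integrals are replaced by their known values within the rule, so that only
    the pointwise estimate remains.\<close>
  proof (rule integral_norm_bound_integral[OF has_integral_integrable[OF has_integral_diff[OF J h]]
        has_integral_integrable[OF W],
        unfolded integral_unique[OF has_integral_diff[OF J h]] integral_unique[OF W]])
    fix r :: real assume "r \<in> {0..1}"
    then show "norm (\<omega> * phase_kernel x k (of_real r * \<omega>) - ?h r)
        \<le> 3459 * exp 4 * (1 + k\<^sup>2) * (r\<^sup>2 * exp (- (x * r ^ 3 / 48)))"
      using phase_kernel_ray[of x k r] x k n\<omega>
      by (simp only: norm_mult \<omega>_def flip: right_diff_distrib) simp
  qed
  also have "\<dots> \<le> 3459 * exp 4 * (1 + k\<^sup>2) * (16 / x * 1)"
    using x by (intro mult_left_mono) auto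
  finally have A: "norm (J - (\<omega> * of_real (E 0) - \<i> * of_real k * \<omega>\<^sup>2 * of_real (E 1)))
      \<le> 55344 * exp 4 * ((1 + k\<^sup>2) / x)"
    by simp
  have G: "\<bar>E j - gamma_term j x\<bar> \<le> 2 / x" if "j \<le> 2" for j
    using integral_power_exp_cube[of x j] x that by (simp add: E_def gamma_term_def)
  have "norm ((\<omega> * of_real (E 0) - \<i> * of_real k * \<omega>\<^sup>2 * of_real (E 1)) -
      (\<omega> * of_real (gamma_term 0 x) - \<i> * of_real k * \<omega>\<^sup>2 * of_real (gamma_term 1 x))) =
      norm (\<omega> * of_real (E 0 - gamma_term 0 x) - \<i> * of_real k * \<omega>\<^sup>2 * of_real (E 1 - gamma_term 1 x))"
    by (simp add: algebra_simps)
  also have "\<dots> \<le> norm (\<omega> * of_real (E 0 - gamma_term 0 x)) +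
      norm (\<i> * of_real k * \<omega>\<^sup>2 * of_real (E 1 - gamma_term 1 x))"
    by (rule norm_triangle_ineq4)
  also have "\<dots> = \<bar>E 0 - gamma_term 0 x\<bar> + \<bar>k\<bar> * \<bar>E 1 - gamma_term 1 x\<bar>"
    by (simp only: norm_mult norm_power norm_of_real n\<omega> norm_ii) simp
  also have "\<dots> \<le> 2 / x + \<bar>k\<bar> * (2 / x)"
    by (intro add_mono mult_left_mono G) auto
  also have "\<dots> = 2 * (1 + \<bar>k\<bar>) / x"
    by (simp add: add_divide_distrib)
  also have "\<dots> \<le> 4 * (1 + k\<^sup>2) / x"
  proof (rule divide_right_mono)
    have "2 * \<bar>k\<bar> \<le> 1 + k\<^sup>2"
      using sum_squares_bound[of 1 "\<bar>k\<bar>"] by simp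
    then show "2 * (1 + \<bar>k\<bar>) \<le> 4 * (1 + k\<^sup>2)"
      using zero_le_power2[of k] by argo
  qed (use x in simp)
  finally have B: "norm ((\<omega> * of_real (E 0) - \<i> * of_real k * \<omega>\<^sup>2 * of_real (E 1)) -
      (\<omega> * of_real (gamma_term 0 x) - \<i> * of_real k * \<omega>\<^sup>2 * of_real (gamma_term 1 x)))
      \<le> 4 * ((1 + k\<^sup>2) / x)"
    by simp
  have "norm (integral {0..pi} (\<lambda>t. phase_kernel x k (of_real t)) - J) \<le> (160 * exp 2 + 2) / x"
    using phase_kernel_contour[OF x k] by (simp add: J_def \<omega>_def)
  also have "\<dots> \<le> (160 * exp 2 + 2) * (1 + k\<^sup>2) / x"
  proof (rule divide_right_mono)
    have "(160 * exp 2 + 2 :: real) * 1 \<le> (160 * exp 2 + 2) * (1 + k\<^sup>2)"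
      by (intro mult_left_mono add_nonneg_nonneg mult_nonneg_nonneg) auto
    then show "160 * exp 2 + 2 \<le> (160 * exp 2 + 2) * (1 + k\<^sup>2)"
      by simp
  qed (use x in simp)
  finally have C: "norm (integral {0..pi} (\<lambda>t. phase_kernel x k (of_real t)) - J)
      \<le> (160 * exp 2 + 2) * ((1 + k\<^sup>2) / x)"
    by simp
  have "norm (integral {0..pi} (\<lambda>t. phase_kernel x k (of_real t)) -
           (\<omega> * of_real (gamma_term 0 x) - \<i> * of_real k * \<omega>\<^sup>2 * of_real (gamma_term 1 x)))
      \<le> (160 * exp 2 + 2) * ((1 + k\<^sup>2) / x) + (55344 * exp 4 * ((1 + k\<^sup>2) / x) + 4 * ((1 + k\<^sup>2) / x))"
    by (intro norm_diff_triangle_le[OF C] norm_diff_triangle_le[OF A] B)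
  also have "\<dots> = (55344 * exp 4 + 160 * exp 2 + 6) * ((1 + k\<^sup>2) / x)"
    by (simp only: distrib_right)
  finally show ?thesis by simp
qed

section \<open>Return to Anger's function\<close>

lemma cis_pi_of_int: "cis (pi * of_int k) = of_real ((-1) powi k)"
  by (cases "even k") (auto simp: complex_eq_iff)

lemma anger_eq_phase_kernel:
  fixes k :: int
  shows "anger (x + of_int k) (- x) =
    Re (of_real ((-1) powi k) * cis (pi * x) *
        integral {0..pi} (\<lambda>t. phase_kernel x (of_int k) (of_real t))) / pi"
proof -
  let ?c = "of_real ((-1) powi k) * cis (pi * x) :: complex"
  let ?K = "\<lambda>t. phase_kernel x (of_int k) (of_real t)"
  have "(?K has_integral integral {0..pi} ?K) {0..pi}"
    unfolding phase_kernel_def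
    by (intro integrable_integral integrable_continuous_interval continuous_intros)
  then have "((\<lambda>t. Re (?c * ?K t)) has_integral Re (?c * integral {0..pi} ?K)) {0..pi}"
    by (intro has_integral_Re has_integral_mult_right)
  moreover have "Re (?c * ?K t) = cos ((x + of_int k) * (pi - t) - - x * sin (pi - t))" for t
  proof -
    have "?K t = cis (- (x * (t - sin t) + of_int k * t))"
      by (simp add: phase_kernel_def cis_conv_exp sin_of_real algebra_simps)
    then have "?c * ?K t = cis (pi * of_int k + pi * x + - (x * (t - sin t) + of_int k * t))"
      by (simp only: cis_pi_of_int[symmetric] cis_mult)
    also have "pi * of_int k + pi * x + - (x * (t - sin t) + of_int k * t) =
        (x + of_int k) * (pi - t) - - x * sin (pi - t)"
      by (simp add: algebra_simps)
    finally show ?thesis by simp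
  qed
  ultimately have "((\<lambda>t. cos ((x + of_int k) * (pi - t) - - x * sin (pi - t))) has_integral
      Re (?c * integral {0..pi} ?K)) {0..pi}"
    by simp
  \<comment> \<open>The reflection \<open>t = pi - \<theta>\<close>, which maps the interval onto
    itself.\<close>
  from has_integral_affinity[OF this[unfolded cbox_interval[symmetric]], of "-1" pi]
  have "((\<lambda>\<theta>. cos ((x + of_int k) * \<theta> - - x * sin \<theta>)) has_integral
      Re (?c * integral {0..pi} ?K)) {0..pi}"
    by simp
  then show ?thesis
    unfolding anger_def by (simp add: integral_unique)
qed

text \<open>The factors \<omega> and \<open>\<omega>\<^sup>2\<close> shift the phase by
  \<open>pi / 6\<close> and \<open>pi / 3\<close>, and \<open>Re (- \<i> * cis a) = sin a\<close>
  turns the \<open>k\<close>-term into a sine with a plus sign.\<close>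

lemma anger_main_eq:
  fixes k :: int
  assumes x: "x > 0"
  defines "\<omega> \<equiv> cis (- (pi / 6))"
  shows "anger_main k x = Re (of_real ((-1) powi k) * cis (pi * x) *
      (\<omega> * of_real (gamma_term 0 x) - \<i> * of_int k * \<omega>\<^sup>2 * of_real (gamma_term 1 x))) / pi"
proof -
  define s :: real where "s = (-1) powi k"
  have \<omega>: "cis (pi * x) * \<omega> = cis (pi * (x - 1 / 6))"
    "cis (pi * x) * \<omega>\<^sup>2 = cis (pi * (x - 1 / 3))"
    by (simp_all add: \<omega>_def cis_mult Complex.DeMoivre algebra_simps)
  have "of_real s * cis (pi * x) *
      (\<omega> * of_real (gamma_term 0 x) - \<i> * of_int k * \<omega>\<^sup>2 * of_real (gamma_term 1 x)) =
      of_real s * (cis (pi * (x - 1 / 6)) * of_real (gamma_term 0 x) -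
        \<i> * of_real (of_int k * gamma_term 1 x) * cis (pi * (x - 1 / 3)))"
    unfolding \<omega>[symmetric] by (simp add: algebra_simps)
  then have "Re (of_real s * cis (pi * x) *
      (\<omega> * of_real (gamma_term 0 x) - \<i> * of_int k * \<omega>\<^sup>2 * of_real (gamma_term 1 x))) =
      s * (cos (pi * (x - 1 / 6)) * gamma_term 0 x +
      of_int k * gamma_term 1 x * sin (pi * (x - 1 / 3)))"
    by (simp only:) simp
  then show ?thesis
    using x by (simp add: anger_main_def gamma_term_def field_simps flip: s_def)
qed

section \<open>Symmetry, crude bounds and the final estimate\<close>

lemma abs_anger_le_1: "\<bar>anger \<gamma> x\<bar> \<le> 1"
proof -
  let ?f = "\<lambda>\<theta>. cos (\<gamma> * \<theta> - x * sin \<theta>)"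
  have "norm (integral {0..pi} ?f) \<le> integral {0..pi} (\<lambda>_. 1)"
    by (intro integral_norm_bound_integral integrable_continuous_interval continuous_intros) auto
  then show ?thesis
    by (simp add: anger_def abs_mult divide_simps)
qed

lemma anger_minus: "anger (- \<gamma>) (- x) = anger \<gamma> x"
proof -
  have "cos (- \<gamma> * \<theta> - - x * sin \<theta>) = cos (\<gamma> * \<theta> - x * sin \<theta>)" for \<theta>
    using cos_minus[of "\<gamma> * \<theta> - x * sin \<theta>"] by simp
  then show ?thesis
    by (simp add: anger_def)
qed

text \<open>Both \<open>(-1) powi k\<close> and \<open>sgn x * of_int k\<close> are invariant under
  the simultaneous change of sign.\<close>

lemma anger_main_minus: "anger_main (- k) (- x) = anger_main k x"
  by (simp add: anger_main_def power_int_minus_one_minus sgn_minus)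

text \<open>In this range the error bound \<open>Q\<close> is at least 1, which handles the first
  term. For the second, \<open>(6 / x) powr (2/3) = 6 / x * (x / 6) powr (1/3) \<le> 6 *
  \<bar>k\<bar> / x\<close>, so it is of order \<open>k\<^sup>2 / x\<close>.\<close>

lemma abs_anger_main_le:
  fixes k :: int
  assumes x: "x > 2" and k: "x < \<bar>of_int k\<bar> ^ 3"
  shows "\<bar>anger_main k x\<bar> \<le> (6 * Gamma (1/3) + 6 * Gamma (2/3)) * ((1 + \<bar>of_int k\<bar> ^ 3) / x)"
proof -
  define K where "K = \<bar>of_int k :: real\<bar>"
  have "k \<noteq> 0"
    using k x by auto
  then have "\<bar>k\<bar> \<ge> 1"
    by linarith
  then have K: "K \<ge> 1" "x < K ^ 3"
    using k by (simp_all add: K_def flip: of_int_abs)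
  define Q where "Q = (1 + K ^ 3) / x"
  have Q: "1 \<le> Q"
    using K x by (simp add: Q_def)
  have G: "Gamma (1/3 :: real) > 0" "Gamma (2/3 :: real) > 0"
    by (auto intro: Gamma_real_pos)
  have "(6 / x) powr (1/3) \<le> 3 powr (1/3)"
    using x by (intro powr_mono2) (auto simp: field_simps)
  also have "\<dots> \<le> 3 powr 1"
    by (intro powr_mono) auto
  finally have A: "(6 / x) powr (1/3) \<le> 3 * Q"
    using Q by simp
  have "(x / 6) powr (1/3) \<le> (K powr 3) powr (1/3)"
    using K x by (intro powr_mono2) auto
  also have "\<dots> = K"
    using K by (simp only: powr_powr) simp
  finally have "(x / 6) powr (1/3) \<le> K" .
  then have "6 / x * (x / 6) powr (1/3) \<le> 6 / x * K"
    using x by (intro mult_left_mono) auto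
  also have "6 / x * (x / 6) powr (1/3) = (6 / x) powr (2/3)"
  proof -
    have "(x / 6) powr (1/3) = (6 / x) powr (- (1/3))"
      using x by (simp add: powr_minus powr_divide field_simps)
    moreover have "6 / x * (6 / x) powr (- (1/3)) = (6 / x) powr (1 + - (1/3))"
      using x by (subst powr_add) auto
    ultimately show ?thesis by simp
  qed
  finally have "K * (6 / x) powr (2/3) \<le> K * (6 / x * K)"
    using K by (intro mult_left_mono) auto
  also have "\<dots> = 6 * (K ^ 2 / x)"
    by (simp add: power2_eq_square)
  also have "\<dots> \<le> 6 * Q"
    using K x power_increasing[of 2 3 K] unfolding Q_def
    by (intro mult_left_mono divide_right_mono) auto
  finally have B: "K * (6 / x) powr (2/3) \<le> 6 * Q" .
  let ?a = "Gamma (1/3) * (6 / x) powr (1/3) * cos (pi * (x - 1/6))"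
  let ?b = "of_int k * Gamma (2/3) * (6 / x) powr (2/3) * sin (pi * (x - 1/3))"
  have "\<bar>?a\<bar> \<le> Gamma (1/3) * (6 / x) powr (1/3) * 1"
    unfolding abs_mult using G by (intro mult_mono) auto
  also have "\<dots> \<le> Gamma (1/3) * (3 * Q)"
    using A G by simp
  finally have a: "\<bar>?a\<bar> \<le> 6 * Gamma (1/3) * Q"
    using G Q mult_pos_pos[of "Gamma (1/3)" Q] by linarith
  have "\<bar>?b\<bar> \<le> K * Gamma (2/3) * (6 / x) powr (2/3) * 1"
    unfolding abs_mult K_def using G by (intro mult_mono) auto
  also have "\<dots> = Gamma (2/3) * (K * (6 / x) powr (2/3))"
    by simp
  also have "\<dots> \<le> Gamma (2/3) * (6 * Q)"
    using B G by (intro mult_left_mono) auto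
  finally have b: "\<bar>?b\<bar> \<le> 6 * Gamma (2/3) * Q"
    by simp
  have "\<bar>(-1) powi k :: real\<bar> = 1"
    by (cases "even k") auto
  then have "\<bar>anger_main k x\<bar> = \<bar>?a + ?b\<bar> / (3 * pi)"
    using x by (simp add: anger_main_def abs_mult)
  also have "\<dots> \<le> \<bar>?a + ?b\<bar> / 1"
    using pi_gt3 by (intro divide_left_mono) auto
  also have "\<dots> \<le> (6 * Gamma (1/3) + 6 * Gamma (2/3)) * Q"
    using a b abs_triangle_ineq[of ?a ?b] by (simp add: distrib_right)
  finally show ?thesis
    by (simp add: Q_def K_def)
qed

text \<open>The cases are split at \<open>\<bar>k\<bar> ^ 3 = x\<close>. In \<open>C\<close>, the
  part \<open>2 * D\<close> serves the contour estimate, doubled in passing from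
  \<open>1 + k\<^sup>2\<close> to \<open>1 + \<bar>k\<bar> ^ 3\<close>; the summand 1 bounds Anger's
  function and \<open>G\<close> the leading terms when \<open>k\<close> is large.\<close>

lemma anger_asymptotics_pos:
  fixes k :: int
  defines "C \<equiv> 2 * (55344 * exp 4 + 160 * exp 2 + 6) + 1 + 6 * Gamma (1/3) + 6 * Gamma (2/3)"
  assumes x: "x > 2"
  shows "\<bar>anger (x + of_int k) (- x) - anger_main k x\<bar> \<le> C * ((1 + \<bar>of_int k\<bar> ^ 3) / x)"
proof -
  define K where "K = \<bar>of_int k :: real\<bar>"
  define Q where "Q = (1 + K ^ 3) / x"
  define D :: real where "D = 55344 * exp 4 + 160 * exp 2 + 6"
  define G :: real where "G = 6 * Gamma (1/3) + 6 * Gamma (2/3)"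
  have C: "C = 2 * D + 1 + G"
    by (simp add: C_def D_def G_def)
  have D0: "D \<ge> 0"
    by (simp add: D_def)
  have G0: "G \<ge> 0"
    by (simp add: G_def Gamma_real_nonneg)
  have K0: "K \<ge> 0"
    by (simp add: K_def)
  have Q0: "Q \<ge> 0"
    using K0 x by (simp add: Q_def)
  have "\<bar>anger (x + of_int k) (- x) - anger_main k x\<bar> \<le> C * Q"
  proof (cases "K ^ 3 \<le> x")
    case True
    let ?I = "integral {0..pi} (\<lambda>t. phase_kernel x (of_int k) (of_real t))"
    let ?M = "cis (- (pi / 6)) * of_real (gamma_term 0 x) -
      \<i> * of_int k * (cis (- (pi / 6)))\<^sup>2 * of_real (gamma_term 1 x)"
    let ?c = "of_real ((-1) powi k) * cis (pi * x) :: complex"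
    have "norm ?c = 1"
      by (cases "even k") (auto simp: norm_mult)
    have "\<bar>anger (x + of_int k) (- x) - anger_main k x\<bar> = \<bar>Re (?c * (?I - ?M))\<bar> / pi"
    proof -
      have "anger_main k x = Re (?c * ?M) / pi"
        using anger_main_eq[of x k] x by simp
      then have "anger (x + of_int k) (- x) - anger_main k x = Re (?c * (?I - ?M)) / pi"
        by (simp only: anger_eq_phase_kernel right_diff_distrib minus_complex.simps diff_divide_distrib)
      then show ?thesis
        by (simp only: abs_divide) simp
    qed
    also have "\<dots> \<le> norm (?c * (?I - ?M)) / 1"
      using pi_gt3 by (intro frac_le abs_Re_le_cmod) auto
    also have "\<dots> = norm (?I - ?M)"
      using \<open>norm ?c = 1\<close> by (simp only: norm_mult[of ?c] mult_1 div_by_1)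
    also have "\<dots> \<le> D * (1 + (of_int k)\<^sup>2) / x"
      using phase_kernel_integral[of x "of_int k"] x True by (simp add: D_def K_def)
    also have "\<dots> = D * ((1 + K\<^sup>2) / x)"
      by (simp add: K_def)
    also have "\<dots> \<le> D * (2 * Q)"
    proof -
      have "K\<^sup>2 \<le> 1 + K ^ 3"
      proof (cases "K \<le> 1")
        case True
        then show ?thesis
          using K0 power_le_one[of K 2] zero_le_power[of K 3] by linarith
      next
        case False
        then have "K\<^sup>2 \<le> K ^ 3"
          by (intro power_increasing) auto
        then show ?thesis by simp
      qed
      then have "1 + K\<^sup>2 \<le> 2 * (1 + K ^ 3)"
        using zero_le_power[OF K0, of 3] by argo
      then have "(1 + K\<^sup>2) / x \<le> 2 * (1 + K ^ 3) / x"
        using x by (intro divide_right_mono) auto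
      then show ?thesis
        using D0 by (intro mult_left_mono) (simp_all add: Q_def)
    qed
    also have "\<dots> \<le> C * Q"
      unfolding C using Q0 G0 by (simp add: distrib_right)
    finally show ?thesis .
  next
    case False
    then have "\<bar>anger_main k x\<bar> \<le> G * Q"
      using abs_anger_main_le[of x k] x by (simp add: G_def Q_def K_def)
    moreover have "1 \<le> Q"
      using False x by (simp add: Q_def)
    moreover have "0 \<le> D * Q"
      using D0 Q0 by simp
    ultimately show ?thesis
      unfolding C using abs_anger_le_1[of "x + of_int k" "- x"] by (simp add: distrib_right)
  qed
  then show ?thesis
    by (simp add: Q_def K_def)
qed

theorem theorem3p3:
  shows "\<exists>C::real. \<forall>(k::int) (x::real). \<bar>x\<bar> > 2 \<longrightarrow>
           (\<exists>R::real. anger (x + of_int k) (- x) = anger_main k x + R \<and>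
              \<bar>R\<bar> \<le> C * ((1 + \<bar>of_int k\<bar> ^ 3) / \<bar>x\<bar>))"
proof -
  define C :: real where
    "C = 2 * (55344 * exp 4 + 160 * exp 2 + 6) + 1 + 6 * Gamma (1/3) + 6 * Gamma (2/3)"
  have "\<bar>anger (x + of_int k) (- x) - anger_main k x\<bar> \<le> C * ((1 + \<bar>of_int k\<bar> ^ 3) / \<bar>x\<bar>)"
    if x: "\<bar>x\<bar> > 2" for k :: int and x :: real
  proof (cases "x > 0")
    case True
    then show ?thesis
      using anger_asymptotics_pos[of x k] x by (simp add: C_def)
  next
    case False
    \<comment> \<open>Changing both signs reduces negative \<open>x\<close> to the positive case
      with \<open>- k\<close>; the error bound depends only on absolute values.\<close>
    have "anger (x + of_int k) (- x) = anger (- x + of_int (- k)) (- (- x))"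
      using anger_minus[of "x + of_int k" "- x"] by (simp add: algebra_simps)
    then show ?thesis
      using anger_asymptotics_pos[of "- x" "- k"] anger_main_minus[of k x] x False
      by (simp add: C_def)
  qed
  then show ?thesis
    by (intro exI[of _ C] allI impI exI[of _ "anger _ _ - anger_main _ _"]) auto
qed

end
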